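(* Let $\lambda>0$ be a real number and let $X=f_1e_1+f_2e_2+f_3e_3$ be a vector field on $(H_3,g_0)$, where $f_1,f_2,f_3$ are smooth real functions of $(x,y,z)\in\mathbb{R}^3$. Then $X$ is an affine vector field on $(H_3,g_0)$ if and only if there exist real constants $c_1,c_2,c_3,c_4$ such that $$\begin{cases} f_1(x,y,z)=c_1x+c_2,\\ f_2(x,y,z)=-\lambda c_1y+c_3,\\ f_3(x,y,z)=\frac{\lambda^2c_1}{2}y^2+\frac{c_1}{2}x^2+c_2x-\lambda c_3y+c_4.\end{cases}$$
   Context: The Heisenberg group $H_3$ is $\mathbb{R}^3$ with global coordinates $(x,y,z)$ and multiplication $(x,y,z)(\tilde x,\tilde y,\tilde z)=(x+\tilde x,y+\tilde y,z+\tilde z-x\tilde y)$. For $\lambda>0$, $g_0$ is the left-invariant Riemannian metric $g_0=\frac{1}{\lambda^2}dx^2+dy^2+(x\,dy+dz)^2$, with left-invariant orthonormal frame $e_1=\partial_y-x\partial_z$, $e_2=\lambda\partial_x$, $e_3=\partial_z$. A smooth vector field $X$ on a pseudo-Riemannian manifold $(M,g)$ with Levi-Civita connection $\nabla$ is affine if $\mathcal{L}_X\nabla=0$, i.e. $[X,\nabla_YZ]=\nabla_{[X,Y]}Z+\nabla_Y[X,Z]$ for all vector fields $Y,Z$. *)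

theory Defs
  imports "HOL-Analysis.Analysis"
begin

section \<open>Calculus on a vector space, regarded as a manifold with one global chart\<close>

primrec times_cont_diff ::
  "nat \<Rightarrow> ('a::euclidean_space \<Rightarrow> 'b::real_normed_vector) \<Rightarrow> bool" where
  "times_cont_diff 0 f \<longleftrightarrow> continuous_on UNIV f"
| "times_cont_diff (Suc k) f \<longleftrightarrow>
     (\<forall>p. f differentiable (at p)) \<and>
     (\<forall>v. times_cont_diff k (\<lambda>p. frechet_derivative f (at p) v))"

definition smooth :: "('a::euclidean_space \<Rightarrow> 'b::real_normed_vector) \<Rightarrow> bool" where
  "smooth f \<longleftrightarrow> (\<forall>k. times_cont_diff k f)"

text \<open>A vector field is given by its coordinate components, i.e. by a map from the space to itself.\<close>

type_synonym 'a vfield = "'a \<Rightarrow> 'a"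

definition deriv_along ::
  "'a::euclidean_space vfield \<Rightarrow> ('a \<Rightarrow> 'b::real_normed_vector) \<Rightarrow> 'a \<Rightarrow> 'b" where
  "deriv_along Y f p = frechet_derivative f (at p) (Y p)"

text \<open>In coordinates the \<open>i\<close>-th component of the bracket of \<open>Y\<close> and \<open>Z\<close> is
  the derivative of \<open>Z\<^sub>i\<close> along \<open>Y\<close> minus the derivative of \<open>Y\<^sub>i\<close> along \<open>Z\<close>.\<close>

definition lie_bracket :: "'a::euclidean_space vfield \<Rightarrow> 'a vfield \<Rightarrow> 'a vfield" where
  "lie_bracket Y Z = (\<lambda>p. deriv_along Y Z p - deriv_along Z Y p)"

section \<open>The Levi-Civita connection and affine vector fields\<close>

text \<open>Only smooth vector fields matter.  Since the functions of the logic are total, a connection is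
  required to take the value \<open>0\<close> at other arguments, so that it is determined
  by its values on smooth fields.\<close>

definition affine_connection ::
  "('a::euclidean_space vfield \<Rightarrow> 'a vfield \<Rightarrow> 'a vfield) \<Rightarrow> bool" where
  "affine_connection D \<longleftrightarrow>
     (\<forall>Y Z. \<not> (smooth Y \<and> smooth Z) \<longrightarrow> D Y Z = (\<lambda>p. 0)) \<and>
     (\<forall>Y Z. smooth Y \<and> smooth Z \<longrightarrow> smooth (D Y Z)) \<and>
     (\<forall>Y Y' Z. smooth Y \<and> smooth Y' \<and> smooth Z \<longrightarrow>
        D (\<lambda>p. Y p + Y' p) Z = (\<lambda>p. D Y Z p + D Y' Z p)) \<and>
     (\<forall>(f :: 'a \<Rightarrow> real) Y Z. smooth f \<and> smooth Y \<and> smooth Z \<longrightarrow>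
        D (\<lambda>p. f p *\<^sub>R Y p) Z = (\<lambda>p. f p *\<^sub>R D Y Z p)) \<and>
     (\<forall>Y Z Z'. smooth Y \<and> smooth Z \<and> smooth Z' \<longrightarrow>
        D Y (\<lambda>p. Z p + Z' p) = (\<lambda>p. D Y Z p + D Y Z' p)) \<and>
     (\<forall>(f :: 'a \<Rightarrow> real) Y Z. smooth f \<and> smooth Y \<and> smooth Z \<longrightarrow>
        D Y (\<lambda>p. f p *\<^sub>R Z p) = (\<lambda>p. deriv_along Y f p *\<^sub>R Z p + f p *\<^sub>R D Y Z p))"

definition torsion_free ::
  "('a::euclidean_space vfield \<Rightarrow> 'a vfield \<Rightarrow> 'a vfield) \<Rightarrow> bool" where
  "torsion_free D \<longleftrightarrow>
     (\<forall>Y Z. smooth Y \<and> smooth Z \<longrightarrow> (\<lambda>p. D Y Z p - D Z Y p) = lie_bracket Y Z)"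

text \<open>A metric \<open>g\<close> assigns to each point \<open>p\<close> a bilinear form \<open>g p\<close> on the tangent space.\<close>

definition metric_compatible ::
  "('a::euclidean_space \<Rightarrow> 'a \<Rightarrow> 'a \<Rightarrow> real) \<Rightarrow>
   ('a vfield \<Rightarrow> 'a vfield \<Rightarrow> 'a vfield) \<Rightarrow> bool" where
  "metric_compatible g D \<longleftrightarrow>
     (\<forall>Y Z W. smooth Y \<and> smooth Z \<and> smooth W \<longrightarrow>
        (\<forall>p. deriv_along Y (\<lambda>q. g q (Z q) (W q)) p = g p (D Y Z p) (W p) + g p (Z p) (D Y W p)))"

definition levi_civita ::
  "('a::euclidean_space \<Rightarrow> 'a \<Rightarrow> 'a \<Rightarrow> real) \<Rightarrow> 'a vfield \<Rightarrow> 'a vfield \<Rightarrow> 'a vfield" where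
  "levi_civita g = (THE D. affine_connection D \<and> torsion_free D \<and> metric_compatible g D)"

definition affine_vector_field ::
  "('a::euclidean_space \<Rightarrow> 'a \<Rightarrow> 'a \<Rightarrow> real) \<Rightarrow> 'a vfield \<Rightarrow> bool" where
  "affine_vector_field g X \<longleftrightarrow> smooth X \<and>
     (\<forall>Y Z. smooth Y \<and> smooth Z \<longrightarrow>
        lie_bracket X (levi_civita g Y Z) =
        (\<lambda>p. levi_civita g (lie_bracket X Y) Z p + levi_civita g Y (lie_bracket X Z) p))"

section \<open>The Heisenberg group\<close>

text \<open>The global coordinates of \<open>p\<close> are \<open>x = p $ 1\<close>, \<open>y = p $ 2\<close>, \<open>z = p $ 3\<close>.\<close>

definition heis_mult :: "real^3 \<Rightarrow> real^3 \<Rightarrow> real^3" where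
  "heis_mult p q = vector [p $ 1 + q $ 1, p $ 2 + q $ 2, p $ 3 + q $ 3 - p $ 1 * q $ 2]"

definition heis_metric :: "real \<Rightarrow> real^3 \<Rightarrow> real^3 \<Rightarrow> real^3 \<Rightarrow> real" where
  "heis_metric lam p u v =
     1 / lam\<^sup>2 * (u $ 1 * v $ 1) + u $ 2 * v $ 2 +
     (p $ 1 * u $ 2 + u $ 3) * (p $ 1 * v $ 2 + v $ 3)"

definition heis_e1 :: "(real^3) vfield" where
  "heis_e1 p = vector [0, 1, - p $ 1]"

definition heis_e2 :: "real \<Rightarrow> (real^3) vfield" where
  "heis_e2 lam p = vector [lam, 0, 0]"

definition heis_e3 :: "(real^3) vfield" where
  "heis_e3 p = vector [0, 0, 1]"

lemma heis_frame_orthonormal: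
  assumes "lam > 0"
  shows "heis_metric lam p (heis_e1 p) (heis_e1 p) = 1"
    and "heis_metric lam p (heis_e2 lam p) (heis_e2 lam p) = 1"
    and "heis_metric lam p (heis_e3 p) (heis_e3 p) = 1"
    and "heis_metric lam p (heis_e1 p) (heis_e2 lam p) = 0"
    and "heis_metric lam p (heis_e1 p) (heis_e3 p) = 0"
    and "heis_metric lam p (heis_e2 lam p) (heis_e3 p) = 0"
  using assms
  by (simp_all add: heis_metric_def heis_e1_def heis_e2_def heis_e3_def power2_eq_square)

lemma heis_mult_has_derivative:
  "(heis_mult a has_derivative (\<lambda>v. vector [v $ 1, v $ 2, v $ 3 - a $ 1 * v $ 2])) (at p)"
proof -
  have "heis_mult a = (\<lambda>q. a + q - (a $ 1 * q $ 2) *\<^sub>R axis 3 1)"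
    by (auto simp: fun_eq_iff vec_eq_iff forall_3 heis_mult_def axis_def)
  moreover have "(\<lambda>v. vector [v $ 1, v $ 2, v $ 3 - a $ 1 * v $ 2])
      = (\<lambda>v::real^3. 0 + v - (a $ 1 * v $ 2) *\<^sub>R axis 3 1)"
    by (auto simp: fun_eq_iff vec_eq_iff forall_3 axis_def)
  ultimately show ?thesis
    by (auto intro!: derivative_eq_intros bounded_linear_imp_has_derivative
        simp: bounded_linear_vec_nth)
qed

lemma heis_metric_left_invariant:
  "heis_metric lam (heis_mult a p)
     (frechet_derivative (heis_mult a) (at p) u) (frechet_derivative (heis_mult a) (at p) v)
   = heis_metric lam p u v"
  by (simp add: frechet_derivative_at[OF heis_mult_has_derivative, symmetric]
      heis_metric_def heis_mult_def algebra_simps)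

end

theory Submission
  imports Defs
begin

text \<open>Let \<open>A\<close> be the matrix of \<open>Y \<mapsto> - [X, Y]\<close> in the left-invariant frame.  The structure and
  connection coefficients of that frame are constant, so for an affine field \<open>X\<close> the frame derivatives
  of the entries of \<open>A\<close> are linear combinations of these entries with constant coefficients.  The
  integrability conditions of this closed system are linear in \<open>A\<close> and leave only a constant multiple of
  the rotation in the \<open>e\<^sub>1, e\<^sub>2\<close> plane; integrating the resulting equations for the \<open>f\<^sub>i\<close> gives the
  stated formulas.  Conversely, these fields are Killing, hence affine.\<close>

section \<open>Smooth maps and derivatives along vector fields\<close>

text \<open>The affine equation is of second order in the \<open>f\<^sub>i\<close>, but on the frame
  it sees \<open>X\<close> only through the brackets with the frame fields. With the matrix of
  brackets as unknown it becomes a first-order linear system in which the \<open>f\<^sub>i\<close>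
  no longer occur. Its compatibility conditions express that second derivatives commute up to the
  bracket, and for a torsion-free connection they say that \<open>A\<close>, acting as a derivation,
  annihilates the curvature tensor. The curvature of g_0 singles out e_3: the sectional curvature is
  -3 lam^2/4 on the e_1, e_2 plane and lam^2/4 on planes containing e_3. This is why only rotations
  fixing e_3 survive. Two foundations are required. The bracket must act as a commutator, which
  rests on the symmetry of second derivatives. And \<open>levi_civita\<close> is a definite
  description, so an explicit connection must be identified with it by a uniqueness
  argument.\<close>

lemma times_cont_diff_Suc_imp: "times_cont_diff (Suc k) f \<Longrightarrow> times_cont_diff k f"
proof (induction k arbitrary: f)
  case 0
  then show ?case
    by (auto intro!: differentiable_imp_continuous_on simp: differentiable_on_def)
next
  case (Suc k)
  then show ?case
    by (metis times_cont_diff.simps(2))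
qed

lemma smooth_imp_differentiable: "smooth f \<Longrightarrow> f differentiable (at p)"
  unfolding smooth_def by (metis times_cont_diff.simps(2))

lemma smooth_frechet_derivative: "smooth f \<Longrightarrow> smooth (\<lambda>p. frechet_derivative f (at p) v)"
  unfolding smooth_def by (metis times_cont_diff.simps(2))

lemma smooth_has_derivative: "smooth f \<Longrightarrow> (f has_derivative frechet_derivative f (at p)) (at p)"
  using smooth_imp_differentiable frechet_derivative_works by blast

lemma smooth_imp_continuous: "smooth f \<Longrightarrow> continuous_on UNIV f"
  unfolding smooth_def by (metis times_cont_diff.simps(1))

lemma linear_smooth_derivative: "smooth f \<Longrightarrow> linear (frechet_derivative f (at p))"
  using smooth_has_derivative has_derivative_linear by blast

lemma frechet_derivative_eq:
  "(f has_derivative F) (at p) \<Longrightarrow> frechet_derivative f (at p) = F"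
  by (rule frechet_derivative_at[symmetric])

section \<open>Closure properties of smooth maps\<close>

lemma times_cont_diff_const: "times_cont_diff k (\<lambda>p. c)"
  by (induction k arbitrary: c) auto

lemma times_cont_diff_add:
  "times_cont_diff k f \<Longrightarrow> times_cont_diff k g \<Longrightarrow> times_cont_diff k (\<lambda>p. f p + g p)"
proof (induction k arbitrary: f g)
  case 0
  then show ?case by (auto intro: continuous_on_add)
next
  case (Suc k)
  have "frechet_derivative (\<lambda>p. f p + g p) (at p)
      = (\<lambda>v. frechet_derivative f (at p) v + frechet_derivative g (at p) v)" for p
    using Suc.prems
    by (intro frechet_derivative_at[symmetric] has_derivative_add)
      (auto simp: frechet_derivative_works[symmetric])
  then show ?case
    using Suc by auto
qed

lemma (in bounded_linear) times_cont_diff_comp: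
  "times_cont_diff k g \<Longrightarrow> times_cont_diff k (\<lambda>p. f (g p))"
proof (induction k arbitrary: g)
  case 0
  then show ?case by (auto intro: continuous_on)
next
  case (Suc k)
  have "((\<lambda>p. f (g p)) has_derivative (\<lambda>v. f (frechet_derivative g (at p) v))) (at p)" for p
    using Suc.prems
    by (intro has_derivative) (auto simp: frechet_derivative_works[symmetric])
  then have "(\<lambda>p. f (g p)) differentiable (at p)"
    "frechet_derivative (\<lambda>p. f (g p)) (at p) = (\<lambda>v. f (frechet_derivative g (at p) v))" for p
    using frechet_derivative_eq by (auto intro: differentiableI)
  then show ?case
    using Suc by auto
qed

lemma (in bounded_bilinear) times_cont_diff_comp:
  "times_cont_diff k f \<Longrightarrow> times_cont_diff k g \<Longrightarrow> times_cont_diff k (\<lambda>p. prod (f p) (g p))"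
proof (induction k arbitrary: f g)
  case 0
  then show ?case by (auto intro: continuous_on)
next
  case (Suc k)
  have "((\<lambda>p. prod (f p) (g p)) has_derivative
      (\<lambda>v. prod (f p) (frechet_derivative g (at p) v) + prod (frechet_derivative f (at p) v) (g p))) (at p)" for p
    using Suc.prems
    by (intro FDERIV) (auto simp: frechet_derivative_works[symmetric])
  then have "(\<lambda>p. prod (f p) (g p)) differentiable (at p)"
    "frechet_derivative (\<lambda>p. prod (f p) (g p)) (at p)
      = (\<lambda>v. prod (f p) (frechet_derivative g (at p) v) + prod (frechet_derivative f (at p) v) (g p))" for p
    using frechet_derivative_eq by (auto intro: differentiableI)
  \<comment> \<open>The Leibniz rule leaves one factor undifferentiated in each term, so the
    induction hypothesis needs order \<open>k\<close> of \<open>f\<close> and \<open>g\<close>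
    themselves as well as of their derivatives.\<close>
  moreover have "times_cont_diff k f" "times_cont_diff k g"
    using Suc.prems by (blast intro: times_cont_diff_Suc_imp)+
  ultimately show ?case
    using Suc by (auto intro!: times_cont_diff_add)
qed

lemma smooth_const [simp]: "smooth (\<lambda>p. c)"
  by (simp add: smooth_def times_cont_diff_const)

lemma smooth_add: "smooth f \<Longrightarrow> smooth g \<Longrightarrow> smooth (\<lambda>p. f p + g p)"
  by (simp add: smooth_def times_cont_diff_add)

lemma smooth_linear_comp: "bounded_linear L \<Longrightarrow> smooth f \<Longrightarrow> smooth (\<lambda>p. L (f p))"
  by (simp add: smooth_def bounded_linear.times_cont_diff_comp)

lemma smooth_scaleR: "smooth f \<Longrightarrow> smooth g \<Longrightarrow> smooth (\<lambda>p. f p *\<^sub>R g p)"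
  by (simp add: smooth_def bounded_bilinear.times_cont_diff_comp[OF bounded_bilinear_scaleR])

lemma smooth_mult:
  fixes f g :: "'a::euclidean_space \<Rightarrow> real"
  shows "smooth f \<Longrightarrow> smooth g \<Longrightarrow> smooth (\<lambda>p. f p * g p)"
  using smooth_scaleR[of f g] by simp

lemma smooth_minus: "smooth f \<Longrightarrow> smooth (\<lambda>p. - f p)"
  by (rule smooth_linear_comp[OF bounded_linear_minus[OF bounded_linear_ident]])

lemma smooth_diff: "smooth f \<Longrightarrow> smooth g \<Longrightarrow> smooth (\<lambda>p. f p - g p)"
  using smooth_add[of f "\<lambda>p. - g p"] smooth_minus[of g] by simp

lemma smooth_sum: "(\<And>i. i \<in> I \<Longrightarrow> smooth (f i)) \<Longrightarrow> smooth (\<lambda>p. \<Sum>i\<in>I. f i p)"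
  by (induction I rule: infinite_finite_induct) (auto intro: smooth_add)

lemma smooth_ident: "smooth (\<lambda>p. p)"
proof -
  have "times_cont_diff k (\<lambda>p::'a. p)" for k
    by (cases k) (auto simp: times_cont_diff_const)
  then show ?thesis by (simp add: smooth_def)
qed

lemma smooth_nth: "smooth f \<Longrightarrow> smooth (\<lambda>p. f p $ i)"
  by (rule smooth_linear_comp[OF bounded_linear_vec_nth])

lemma smooth_vec:
  fixes f :: "'a::euclidean_space \<Rightarrow> real^'n"
  assumes "\<And>i. smooth (\<lambda>p. f p $ i)"
  shows "smooth f"
proof -
  have "(\<lambda>p. \<Sum>i\<in>UNIV. f p $ i *\<^sub>R axis i 1) = f"
    by (auto simp: fun_eq_iff vec_eq_iff axis_def if_distrib cong: if_cong)
  moreover have "smooth (\<lambda>p. \<Sum>i\<in>UNIV. f p $ i *\<^sub>R (axis i 1 :: real^'n))"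
    by (intro smooth_sum smooth_scaleR assms smooth_const)
  ultimately show ?thesis by simp
qed

lemmas smooth_intros =
  smooth_const smooth_add smooth_diff smooth_minus smooth_mult smooth_scaleR smooth_sum
  smooth_ident smooth_nth

section \<open>Derivatives along vector fields\<close>

lemma deriv_along_eqI: "(f has_derivative F) (at p) \<Longrightarrow> deriv_along Y f p = F (Y p)"
  by (simp add: deriv_along_def frechet_derivative_at[symmetric])

text \<open>Smoothness is defined through derivatives in constant directions. Expanding
  \<open>Y p\<close> in the basis moves the variable direction into scalar coefficients, which makes
  derivatives along smooth fields smooth.\<close>

lemma deriv_along_expand:
  fixes f :: "'a::euclidean_space \<Rightarrow> 'b::real_normed_vector"
  assumes "smooth f"
  shows "deriv_along Y f p = (\<Sum>b\<in>Basis. (Y p \<bullet> b) *\<^sub>R frechet_derivative f (at p) b)"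
  unfolding deriv_along_def
  using linear_sum[OF linear_smooth_derivative[OF assms, of p], of "\<lambda>b. (Y p \<bullet> b) *\<^sub>R b" Basis]
  by (simp add: euclidean_representation linear_scale[OF linear_smooth_derivative[OF assms]])

lemma smooth_deriv_along:
  fixes f :: "'a::euclidean_space \<Rightarrow> 'b::real_normed_vector"
  assumes "smooth Y" "smooth f"
  shows "smooth (deriv_along Y f)"
proof -
  have "deriv_along Y f = (\<lambda>p. \<Sum>b\<in>Basis. (Y p \<bullet> b) *\<^sub>R frechet_derivative f (at p) b)"
    using deriv_along_expand[OF assms(2)] by blast
  then show ?thesis
    using assms
    by (simp add: smooth_sum smooth_scaleR smooth_linear_comp[OF bounded_linear_inner_left]
        smooth_frechet_derivative)
qed

lemma smooth_lie_bracket: "smooth Y \<Longrightarrow> smooth Z \<Longrightarrow> smooth (lie_bracket Y Z)"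
  unfolding lie_bracket_def by (intro smooth_diff smooth_deriv_along)

lemma deriv_along_const [simp]: "deriv_along Y (\<lambda>p. c) p = 0"
  by (simp add: deriv_along_def)

lemma deriv_along_add:
  assumes "smooth f" "smooth g"
  shows "deriv_along Y (\<lambda>p. f p + g p) p = deriv_along Y f p + deriv_along Y g p"
  using deriv_along_eqI[OF has_derivative_add[OF smooth_has_derivative[OF assms(1)]
        smooth_has_derivative[OF assms(2)]]]
  by (simp add: deriv_along_def)

lemma deriv_along_diff:
  assumes "smooth f" "smooth g"
  shows "deriv_along Y (\<lambda>p. f p - g p) p = deriv_along Y f p - deriv_along Y g p"
  using deriv_along_eqI[OF has_derivative_diff[OF smooth_has_derivative[OF assms(1)]
        smooth_has_derivative[OF assms(2)]]]
  by (simp add: deriv_along_def)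

lemma deriv_along_sum:
  assumes "\<And>i. i \<in> I \<Longrightarrow> smooth (f i)"
  shows "deriv_along Y (\<lambda>p. \<Sum>i\<in>I. f i p) p = (\<Sum>i\<in>I. deriv_along Y (f i) p)"
  using deriv_along_eqI[OF has_derivative_sum[OF smooth_has_derivative[OF assms]]]
  by (simp add: deriv_along_def)

lemma deriv_along_linear:
  assumes "bounded_linear L" "smooth f"
  shows "deriv_along Y (\<lambda>p. L (f p)) p = L (deriv_along Y f p)"
  using deriv_along_eqI[OF bounded_linear.has_derivative[OF assms(1) smooth_has_derivative[OF assms(2)]]]
  by (simp add: deriv_along_def)

lemma deriv_along_scaleR:
  assumes "smooth f" "smooth g"
  shows "deriv_along Y (\<lambda>p. f p *\<^sub>R g p) p = deriv_along Y f p *\<^sub>R g p + f p *\<^sub>R deriv_along Y g p"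
  using deriv_along_eqI[OF has_derivative_scaleR[OF smooth_has_derivative[OF assms(1)]
        smooth_has_derivative[OF assms(2)]]]
  by (simp add: deriv_along_def)

lemma deriv_along_mult:
  fixes f g :: "'a::euclidean_space \<Rightarrow> real"
  assumes "smooth f" "smooth g"
  shows "deriv_along Y (\<lambda>p. f p * g p) p = deriv_along Y f p * g p + f p * deriv_along Y g p"
  using deriv_along_scaleR[OF assms] by simp

lemma deriv_along_nth: "smooth f \<Longrightarrow> deriv_along Y (\<lambda>p. f p $ i) p = deriv_along Y f p $ i"
  by (rule deriv_along_linear[OF bounded_linear_vec_nth])

lemma deriv_along_ident [simp]: "deriv_along Y (\<lambda>p. p) p = Y p"
  by (simp add: deriv_along_def)

lemma deriv_along_add_field:
  "smooth f \<Longrightarrow> deriv_along (\<lambda>p. Y p + Z p) f p = deriv_along Y f p + deriv_along Z f p"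
  unfolding deriv_along_def by (rule linear_add[OF linear_smooth_derivative])

lemma deriv_along_scaleR_field:
  "smooth f \<Longrightarrow> deriv_along (\<lambda>p. h p *\<^sub>R Y p) f p = h p *\<^sub>R deriv_along Y f p"
  unfolding deriv_along_def by (rule linear_scale[OF linear_smooth_derivative])

lemma deriv_along_sum_field:
  "smooth f \<Longrightarrow> deriv_along (\<lambda>p. \<Sum>i\<in>I. Y i p) f p = (\<Sum>i\<in>I. deriv_along (Y i) f p)"
  unfolding deriv_along_def by (rule linear_sum[OF linear_smooth_derivative])

section \<open>Symmetry of second derivatives\<close>

lemma smooth_line_mvt:
  fixes f :: "'a::euclidean_space \<Rightarrow> real"
  assumes "smooth f" "t > 0"
  shows "\<exists>s. 0 < s \<and> s < t \<and>
    f (p + t *\<^sub>R u) - f p = t * frechet_derivative f (at (p + s *\<^sub>R u)) u"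
proof -
  have "((\<lambda>s. f (p + s *\<^sub>R u)) has_derivative
      (\<lambda>h. h * frechet_derivative f (at (p + s *\<^sub>R u)) u)) (at s)" for s
  proof -
    have "((\<lambda>s. p + s *\<^sub>R u) has_derivative (\<lambda>h. h *\<^sub>R u)) (at s)"
      by (auto intro!: derivative_eq_intros)
    from has_derivative_compose[OF this smooth_has_derivative[OF assms(1)]]
    show ?thesis
      by (simp add: linear_scale[OF linear_smooth_derivative[OF assms(1)]])
  qed
  then have "\<exists>s\<in>{0<..<t}. f (p + t *\<^sub>R u) - f (p + 0 *\<^sub>R u)
      = (t - 0) * frechet_derivative f (at (p + s *\<^sub>R u)) u"
    by (intro mvt_simple assms(2)) (auto intro: has_derivative_at_withinI)
  then show ?thesis by force
qed

lemma smooth_translate: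
  fixes f :: "'a::euclidean_space \<Rightarrow> 'b::real_normed_vector"
  assumes "smooth f"
  shows "frechet_derivative (\<lambda>p. f (p + a)) (at p) = frechet_derivative f (at (p + a))"
    and "smooth (\<lambda>p. f (p + a))"
proof -
  have hd: "((\<lambda>p. f (p + a)) has_derivative frechet_derivative f (at (p + a))) (at p)"
    if "f differentiable (at (p + a))" for p and f :: "'a \<Rightarrow> 'b"
  proof -
    have "((\<lambda>p. p + a) has_derivative (\<lambda>h. h)) (at p)"
      by (auto intro!: derivative_eq_intros)
    from has_derivative_compose[OF this that[unfolded frechet_derivative_works]]
    show ?thesis by simp
  qed
  show "frechet_derivative (\<lambda>p. f (p + a)) (at p) = frechet_derivative f (at (p + a))"
    by (intro frechet_derivative_eq hd smooth_imp_differentiable assms)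
  have "times_cont_diff k f \<Longrightarrow> times_cont_diff k (\<lambda>p. f (p + a))" for k and f :: "'a \<Rightarrow> 'b"
  proof (induction k arbitrary: f)
    case 0
    then show ?case
      using continuous_on_compose2[of UNIV f UNIV "\<lambda>p. p + a"]
      by (simp add: continuous_on_add)
  next
    case (Suc k)
    then have d: "f differentiable (at p)" for p by simp
    have "(\<lambda>p. f (p + a)) differentiable (at p)"
      "frechet_derivative (\<lambda>p. f (p + a)) (at p) = frechet_derivative f (at (p + a))" for p
      using hd[OF d] frechet_derivative_eq by (auto intro: differentiableI)
    moreover have "times_cont_diff k (\<lambda>p. frechet_derivative f (at (p + a)) v)" for v
      using Suc.prems by (intro Suc.IH[of "\<lambda>p. frechet_derivative f (at p) v"]) simp
    ultimately show ?case
      by simp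
  qed
  then show "smooth (\<lambda>p. f (p + a))"
    using assms by (simp add: smooth_def)
qed

text \<open>Two applications of the mean value theorem: to the increment of \<open>f\<close> by
  \<open>t *\<^sub>R v\<close> as a function along \<open>u\<close>, then to the derivative of
  \<open>f\<close> in direction \<open>u\<close> along \<open>v\<close>.\<close>

lemma second_difference:
  fixes f :: "'a::euclidean_space \<Rightarrow> real"
  assumes "smooth f" "t > 0"
  shows "\<exists>r s. 0 < r \<and> r < t \<and> 0 < s \<and> s < t \<and>
    f (p + t *\<^sub>R u + t *\<^sub>R v) - f (p + t *\<^sub>R u) - f (p + t *\<^sub>R v) + f p
    = t * (t * frechet_derivative (\<lambda>q. frechet_derivative f (at q) u) (at (p + s *\<^sub>R u + r *\<^sub>R v)) v)"
proof -
  let ?g = "\<lambda>q. f (q + t *\<^sub>R v) - f q"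
  note tr = smooth_translate[OF assms(1), of "t *\<^sub>R v"]
  have g: "smooth ?g"
    by (intro smooth_diff tr assms)
  have dg: "frechet_derivative ?g (at q) u
      = frechet_derivative f (at (q + t *\<^sub>R v)) u - frechet_derivative f (at q) u" for q
    using deriv_along_diff[OF tr(2) assms(1), of "\<lambda>_. u" q] by (simp add: deriv_along_def tr)
  obtain s where s: "0 < s" "s < t" "?g (p + t *\<^sub>R u) - ?g p
      = t * frechet_derivative ?g (at (p + s *\<^sub>R u)) u"
    using smooth_line_mvt[OF g assms(2)] by blast
  obtain r where r: "0 < r" "r < t" "frechet_derivative ?g (at (p + s *\<^sub>R u)) u
      = t * frechet_derivative (\<lambda>q. frechet_derivative f (at q) u) (at (p + s *\<^sub>R u + r *\<^sub>R v)) v"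
    unfolding dg
    using smooth_line_mvt[OF smooth_frechet_derivative[OF assms(1)] assms(2)] by blast
  show ?thesis
    using s r by (intro exI[of _ r] exI[of _ s]) (auto simp: algebra_simps)
qed

text \<open>The second difference is symmetric in \<open>u\<close> and \<open>v\<close>. Hence the
  two mixed derivatives agree at a pair of points arbitrarily close to \<open>p\<close>, and
  continuity carries the equality to \<open>p\<close>.\<close>

lemma second_derivative_symmetric_real:
  fixes f :: "'a::euclidean_space \<Rightarrow> real"
  assumes "smooth f"
  shows "frechet_derivative (\<lambda>q. frechet_derivative f (at q) u) (at p) v
    = frechet_derivative (\<lambda>q. frechet_derivative f (at q) v) (at p) u"
proof -
  define A where "A = (\<lambda>p. frechet_derivative (\<lambda>q. frechet_derivative f (at q) u) (at p) v)"
  define B where "B = (\<lambda>p. frechet_derivative (\<lambda>q. frechet_derivative f (at q) v) (at p) u)"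
  have "continuous_on UNIV A" "continuous_on UNIV B"
    unfolding A_def B_def by (intro smooth_imp_continuous smooth_frechet_derivative assms)+
  then have lim: "(A \<longlongrightarrow> A p) (at p)" "(B \<longlongrightarrow> B p) (at p)"
    by (auto simp: continuous_on_def)
  have "\<bar>A p - B p\<bar> < e" if "e > 0" for e
  proof -
    have "continuous (at p) A" "continuous (at p) B"
      using lim by (auto simp: continuous_at)
    then obtain d1 d2 where d: "d1 > 0" "\<And>q. dist q p < d1 \<Longrightarrow> dist (A q) (A p) < e/2"
      "d2 > 0" "\<And>q. dist q p < d2 \<Longrightarrow> dist (B q) (B p) < e/2"
      using \<open>e > 0\<close> unfolding continuous_at_eps_delta by (metis half_gt_zero)
    \<comment> \<open>All intermediate points lie within \<open>t * (norm u + norm v)\<close> of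
      \<open>p\<close>, hence inside both continuity radii; the summand 1 keeps the denominator
      positive when \<open>u\<close> and \<open>v\<close> vanish.\<close>
    define t where "t = min d1 d2 / (norm u + norm v + 1)"
    have n: "norm u + norm v + 1 > 0" by (simp add: add_nonneg_pos)
    have t: "t > 0" using d n by (simp add: t_def)
    have near: "dist (p + s *\<^sub>R u + r *\<^sub>R v) p < min d1 d2" if "0 < r" "r < t" "0 < s" "s < t" for r s
    proof -
      have "dist (p + s *\<^sub>R u + r *\<^sub>R v) p = norm (s *\<^sub>R u + r *\<^sub>R v)"
        by (simp add: dist_norm add.assoc)
      also have "\<dots> \<le> s * norm u + r * norm v"
        using norm_triangle_ineq[of "s *\<^sub>R u" "r *\<^sub>R v"] that by simp
      also have "\<dots> \<le> t * norm u + t * norm v"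
        using that by (intro add_mono mult_right_mono) auto
      also have "\<dots> < t * (norm u + norm v + 1)"
        using t by (simp add: algebra_simps)
      also have "\<dots> = min d1 d2" using n by (simp add: t_def)
      finally show ?thesis .
    qed
    obtain r s where rs: "0 < r" "r < t" "0 < s" "s < t"
      "f (p + t *\<^sub>R u + t *\<^sub>R v) - f (p + t *\<^sub>R u) - f (p + t *\<^sub>R v) + f p
        = t * (t * A (p + s *\<^sub>R u + r *\<^sub>R v))"
      using second_difference[OF assms t, of p u v] unfolding A_def by blast
    obtain r' s' where rs': "0 < r'" "r' < t" "0 < s'" "s' < t"
      "f (p + t *\<^sub>R v + t *\<^sub>R u) - f (p + t *\<^sub>R v) - f (p + t *\<^sub>R u) + f p
        = t * (t * B (p + s' *\<^sub>R v + r' *\<^sub>R u))"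
      using second_difference[OF assms t, of p v u] unfolding B_def by blast
    have "t * (t * A (p + s *\<^sub>R u + r *\<^sub>R v)) = t * (t * B (p + s' *\<^sub>R v + r' *\<^sub>R u))"
      unfolding rs(5)[symmetric] rs'(5)[symmetric] by (simp add: algebra_simps)
    then have "A (p + s *\<^sub>R u + r *\<^sub>R v) = B (p + s' *\<^sub>R v + r' *\<^sub>R u)"
      using t by simp
    moreover have "p + s' *\<^sub>R v + r' *\<^sub>R u = p + r' *\<^sub>R u + s' *\<^sub>R v" by simp
    ultimately show ?thesis
      using d(2)[of "p + s *\<^sub>R u + r *\<^sub>R v"] d(4)[of "p + r' *\<^sub>R u + s' *\<^sub>R v"]
        near[OF rs(1-4)] near[of s' r'] rs'(1-4)
      unfolding dist_real_def by (smt (verit) field_sum_of_halves min_less_iff_conj)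
  qed
  then have "A p = B p"
    by (metis abs_0_eq eq_iff_diff_eq_0 less_irrefl zero_less_abs_iff)
  then show ?thesis by (simp add: A_def B_def)
qed

lemma second_derivative_symmetric:
  fixes f :: "'a::euclidean_space \<Rightarrow> 'b::euclidean_space"
  assumes "smooth f"
  shows "frechet_derivative (\<lambda>q. frechet_derivative f (at q) u) (at p) v
    = frechet_derivative (\<lambda>q. frechet_derivative f (at q) v) (at p) u"
proof (rule euclidean_eqI)
  fix b :: 'b
  have in1: "frechet_derivative (\<lambda>p. g p \<bullet> b) (at q) w = frechet_derivative g (at q) w \<bullet> b"
    if "smooth g" for g :: "'a \<Rightarrow> 'b" and q w
    using deriv_along_linear[OF bounded_linear_inner_left that, of "\<lambda>_. w" b q]
    by (simp add: deriv_along_def)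
  have "smooth (\<lambda>p. f p \<bullet> b)"
    by (intro smooth_linear_comp[OF bounded_linear_inner_left] assms)
  from second_derivative_symmetric_real[OF this, of u p v]
  show "frechet_derivative (\<lambda>q. frechet_derivative f (at q) u) (at p) v \<bullet> b
    = frechet_derivative (\<lambda>q. frechet_derivative f (at q) v) (at p) u \<bullet> b"
    by (simp add: in1 assms smooth_frechet_derivative)
qed

section \<open>The bracket as a commutator and the Jacobi identity\<close>

lemma deriv_along_deriv_along:
  fixes f :: "'a::euclidean_space \<Rightarrow> 'b::real_normed_vector"
  assumes "smooth Y" "smooth f"
  shows "deriv_along X (deriv_along Y f) p =
    frechet_derivative (\<lambda>q. frechet_derivative f (at q) (Y p)) (at p) (X p)
    + frechet_derivative f (at p) (deriv_along X Y p)"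
proof -
  let ?D = "\<lambda>b q. frechet_derivative f (at q) b"
  note D = smooth_frechet_derivative[OF assms(2)]
  note in1 = bounded_linear_inner_left
  have Yb: "smooth (\<lambda>q. Y q \<bullet> b)" for b
    by (intro smooth_linear_comp[OF in1] assms)
  \<comment> \<open>This serves twice: it rewrites the term in which \<open>Y\<close> is
    differentiated, and it reassembles the remaining terms into a derivative in the direction
    \<open>Y p\<close> frozen at \<open>p\<close>.\<close>
  have exp: "?D w = (\<lambda>q. \<Sum>b\<in>Basis. (w \<bullet> b) *\<^sub>R ?D b q)" for w
    using deriv_along_expand[OF assms(2), of "\<lambda>_. w"] by (auto simp: deriv_along_def)
  have "deriv_along Y f = (\<lambda>q. \<Sum>b\<in>Basis. (Y q \<bullet> b) *\<^sub>R ?D b q)"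
    using deriv_along_expand[OF assms(2)] by blast
  then have "deriv_along X (deriv_along Y f) p
      = (\<Sum>b\<in>Basis. deriv_along X (\<lambda>q. (Y q \<bullet> b) *\<^sub>R ?D b q) p)"
    by (simp add: deriv_along_sum smooth_scaleR Yb D)
  also have "\<dots> = (\<Sum>b\<in>Basis. (Y p \<bullet> b) *\<^sub>R deriv_along X (?D b) p)
      + (\<Sum>b\<in>Basis. (deriv_along X Y p \<bullet> b) *\<^sub>R ?D b p)"
    by (simp add: deriv_along_scaleR Yb D deriv_along_linear[OF in1 assms(1)] sum.distrib add.commute)
  also have "(\<Sum>b\<in>Basis. (deriv_along X Y p \<bullet> b) *\<^sub>R ?D b p) = ?D (deriv_along X Y p) p"
    using fun_cong[OF exp[of "deriv_along X Y p"], of p] by simp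
  also have "(\<Sum>b\<in>Basis. (Y p \<bullet> b) *\<^sub>R deriv_along X (?D b) p)
      = deriv_along X (?D (Y p)) p"
    by (subst exp[of "Y p"])
      (simp add: deriv_along_sum smooth_scaleR D deriv_along_scaleR)
  finally show ?thesis by (simp add: deriv_along_def[of X])
qed

text \<open>The second-order parts of the two iterated derivatives cancel by symmetry; what remains
  is the derivative of \<open>f\<close> in the direction of the bracket.\<close>

lemma deriv_along_lie_bracket:
  fixes f :: "'a::euclidean_space \<Rightarrow> 'b::euclidean_space"
  assumes "smooth X" "smooth Y" "smooth f"
  shows "deriv_along (lie_bracket X Y) f p
    = deriv_along X (deriv_along Y f) p - deriv_along Y (deriv_along X f) p"
  using second_derivative_symmetric[OF assms(3), of "X p" p "Y p"]
  by (simp add: deriv_along_deriv_along assms lie_bracket_def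
      deriv_along_def[of "\<lambda>p. deriv_along X Y p - deriv_along Y X p"]
      linear_diff[OF linear_smooth_derivative[OF assms(3)]])

text \<open>In a global chart vector fields are themselves vector-valued functions. The commutator
  formula therefore applies to them, and both sides expand into the same iterated
  derivatives.\<close>

lemma lie_bracket_jacobi:
  assumes "smooth X" "smooth Y" "smooth Z"
  shows "lie_bracket X (lie_bracket Y Z) p
    = lie_bracket (lie_bracket X Y) Z p + lie_bracket Y (lie_bracket X Z) p"
proof -
  have *: "deriv_along U (lie_bracket V W) p
      = deriv_along U (deriv_along V W) p - deriv_along U (deriv_along W V) p"
    if "smooth U" "smooth V" "smooth W" for U V W :: "'a vfield"
    unfolding lie_bracket_def using that by (intro deriv_along_diff smooth_deriv_along)
  show ?thesis
    by (simp add: lie_bracket_def[of X "lie_bracket Y Z"] lie_bracket_def[of "lie_bracket X Y" Z]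
        lie_bracket_def[of Y "lie_bracket X Z"] * assms deriv_along_lie_bracket)
qed

section \<open>Killing fields are affine\<close>

text \<open>The properties of a pseudo-Riemannian metric behind both the uniqueness of its
  Levi-Civita connection and the passage from Killing to affine fields.\<close>

locale smooth_metric =
  fixes g :: "'a::euclidean_space \<Rightarrow> 'a \<Rightarrow> 'a \<Rightarrow> real"
  assumes add_left: "g p (u + v) w = g p u w + g p v w"
    and commute: "g p u v = g p v u"
    and nondegenerate: "(\<And>v. g p u v = 0) \<Longrightarrow> u = 0"
    and smooth_metric: "smooth Z \<Longrightarrow> smooth W \<Longrightarrow> smooth (\<lambda>p. g p (Z p) (W p))"
begin

lemma diff_left: "g p (u - v) w = g p u w - g p v w"
  using add_left[of p "u - v" v w] by simp

lemma diff_right: "g p w (u - v) = g p w u - g p w v"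
  by (metis diff_left commute)

text \<open>The trilinear expression \<open>g p (T Y Z p) (W p)\<close> is symmetric in
  \<open>Y\<close>, \<open>Z\<close> and skew in \<open>Z\<close>, \<open>W\<close>. Alternating the
  two exchanges three times each returns to the start with three sign changes, so the expression
  equals its negative.\<close>

lemma sym_skew_zero:
  assumes "\<And>Y Z. smooth Y \<Longrightarrow> smooth Z \<Longrightarrow> T Y Z p = T Z Y p"
    and "\<And>Y Z W. smooth Y \<Longrightarrow> smooth Z \<Longrightarrow> smooth W \<Longrightarrow>
      g p (T Y Z p) (W p) = - g p (Z p) (T Y W p)"
    and "smooth Y" "smooth Z"
  shows "T Y Z p = 0"
proof (rule nondegenerate)
  fix v :: 'a
  \<comment> \<open>The hypotheses concern fields, so the test vector \<open>v\<close> is extended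
    to a constant field.\<close>
  define W where "W = (\<lambda>q::'a. v)"
  have "smooth W" by (simp add: W_def)
  with assms have "g p (T Y Z p) (W p) = - g p (T Y Z p) (W p)"
    by (smt (verit) commute)
  then show "g p (T Y Z p) v = 0" by (simp add: W_def)
qed

text \<open>The difference of two candidates is symmetric because their torsions agree, and skew
  because the derivatives of the metric cancel. On non-smooth arguments both take the prescribed
  value 0.\<close>

lemma levi_civita_eq:
  assumes "affine_connection D" "torsion_free D" "metric_compatible g D"
  shows "levi_civita g = D"
  unfolding levi_civita_def
proof (rule the_equality)
  show "affine_connection D \<and> torsion_free D \<and> metric_compatible g D"
    using assms by blast
next
  fix D'
  assume D': "affine_connection D' \<and> torsion_free D' \<and> metric_compatible g D'"
  show "D' = D"
  proof (intro ext)
    fix Y Z p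
    show "D' Y Z p = D Y Z p"
    proof (cases "smooth Y \<and> smooth Z")
      case False
      then show ?thesis
        using assms(1) D' unfolding affine_connection_def by simp
    next
      case True
      have "D' Y Z p - D Y Z p = 0"
      proof (rule sym_skew_zero[where T = "\<lambda>Y Z p. D' Y Z p - D Y Z p"])
        fix Y Z :: "'a vfield"
        assume "smooth Y" "smooth Z"
        then have "(\<lambda>p. D' Y Z p - D' Z Y p) = (\<lambda>p. D Y Z p - D Z Y p)"
          using assms(2) D' unfolding torsion_free_def by simp
        from fun_cong[OF this, of p] show "D' Y Z p - D Y Z p = D' Z Y p - D Z Y p"
          by (simp add: algebra_simps)
      next
        fix Y Z W :: "'a vfield"
        assume s: "smooth Y" "smooth Z" "smooth W"
        have "deriv_along Y (\<lambda>q. g q (Z q) (W q)) p = g p (F Y Z p) (W p) + g p (Z p) (F Y W p)"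
          if "metric_compatible g F" for F
          using that s unfolding metric_compatible_def by blast
        from this[OF assms(3)] this[of D'] D'
        show "g p (D' Y Z p - D Y Z p) (W p) = - g p (Z p) (D' Y W p - D Y W p)"
          by (simp add: diff_left diff_right)
      qed (use True in auto)
      then show ?thesis by simp
    qed
  qed
qed

text \<open>The Lie derivative of the connection is symmetric by the Jacobi identity; along a Killing field
  it is moreover skew with respect to the metric.\<close>

lemma killing_imp_affine:
  assumes D: "affine_connection D" "torsion_free D" "metric_compatible g D"
    and X: "smooth X"
    and killing: "\<And>Y Z p. smooth Y \<Longrightarrow> smooth Z \<Longrightarrow>
      deriv_along X (\<lambda>q. g q (Y q) (Z q)) p
      = g p (lie_bracket X Y p) (Z p) + g p (Y p) (lie_bracket X Z p)"
  shows "affine_vector_field g X"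
proof -
  note br = smooth_lie_bracket
  have sD: "smooth (D Y Z)" if "smooth Y" "smooth Z" for Y Z
    using D(1) that unfolding affine_connection_def by blast
  have compat: "deriv_along Y (\<lambda>q. g q (Z q) (W q)) p
      = g p (D Y Z p) (W p) + g p (Z p) (D Y W p)" if "smooth Y" "smooth Z" "smooth W" for Y Z W p
    using D(3) that unfolding metric_compatible_def by blast
  have tor: "D Y Z = (\<lambda>p. D Z Y p + lie_bracket Y Z p)" if "smooth Y" "smooth Z" for Y Z
  proof -
    have "lie_bracket Y Z = (\<lambda>p. D Y Z p - D Z Y p)"
      using D(2) that unfolding torsion_free_def by simp
    then show ?thesis by (simp add: fun_eq_iff)
  qed
  define L where "L = (\<lambda>Y Z p. lie_bracket X (D Y Z) p - D (lie_bracket X Y) Z p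
    - D Y (lie_bracket X Z) p)"
  have "L Y Z p = 0" if "smooth Y" "smooth Z" for Y Z p
  proof (rule sym_skew_zero[where T = L, OF _ _ that])
    fix Y Z :: "'a vfield"
    assume s: "smooth Y" "smooth Z"
    have "lie_bracket X (D Y Z) p = lie_bracket X (D Z Y) p + lie_bracket X (lie_bracket Y Z) p"
      unfolding tor[OF s] using s X
      by (simp add: lie_bracket_def[of X] deriv_along_add deriv_along_add_field sD br)
    moreover have "D (lie_bracket X Y) Z p = D Z (lie_bracket X Y) p + lie_bracket (lie_bracket X Y) Z p"
      by (rule fun_cong[OF tor[OF br[OF X s(1)] s(2)]])
    moreover have "D Y (lie_bracket X Z) p = D (lie_bracket X Z) Y p + lie_bracket Y (lie_bracket X Z) p"
      by (rule fun_cong[OF tor[OF s(1) br[OF X s(2)]]])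
    ultimately show "L Y Z p = L Z Y p"
      using lie_bracket_jacobi[OF X s, of p] by (simp add: L_def)
  next
    fix Y Z W :: "'a vfield"
    assume s: "smooth Y" "smooth Z" "smooth W"
    let ?B = "lie_bracket X"
    note sm = smooth_metric
    \<comment> \<open>The function g(Z, W) is differentiated along \<open>Y\<close> and
      \<open>X\<close> in both orders: compatibility resolves derivatives along \<open>Y\<close>,
      the Killing equation those along \<open>X\<close>.\<close>
    have "deriv_along X (deriv_along Y (\<lambda>q. g q (Z q) (W q))) p
        = deriv_along X (\<lambda>q. g q (D Y Z q) (W q) + g q (Z q) (D Y W q)) p"
      using compat s by presburger
    also have "\<dots> = g p (?B (D Y Z) p) (W p) + g p (D Y Z p) (?B W p)
        + (g p (?B Z p) (D Y W p) + g p (Z p) (?B (D Y W) p))"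
      using s by (simp add: deriv_along_add sm sD killing)
    finally have XY: "deriv_along X (deriv_along Y (\<lambda>q. g q (Z q) (W q))) p = \<dots>" .
    have "deriv_along Y (deriv_along X (\<lambda>q. g q (Z q) (W q))) p
        = deriv_along Y (\<lambda>q. g q (?B Z q) (W q) + g q (Z q) (?B W q)) p"
      using killing s by presburger
    also have "\<dots> = g p (D Y (?B Z) p) (W p) + g p (?B Z p) (D Y W p)
        + (g p (D Y Z p) (?B W p) + g p (Z p) (D Y (?B W) p))"
      using s X by (simp add: deriv_along_add sm br compat)
    finally have YX: "deriv_along Y (deriv_along X (\<lambda>q. g q (Z q) (W q))) p = \<dots>" .
    \<comment> \<open>The commutator of the two orders is the derivative along
      \<open>[X, Y]\<close>. The mixed products cancel, and the other terms combine to the skewness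
      of \<open>L\<close>.\<close>
    have "deriv_along (?B Y) (\<lambda>q. g q (Z q) (W q)) p
        = g p (D (?B Y) Z p) (W p) + g p (Z p) (D (?B Y) W p)"
      using s X by (simp add: compat br)
    with deriv_along_lie_bracket[OF X s(1) sm[OF s(2,3)], of p] XY YX
    show "g p (L Y Z p) (W p) = - g p (Z p) (L Y W p)"
      by (simp add: L_def diff_left diff_right)
  qed
  then show ?thesis
    unfolding affine_vector_field_def levi_civita_eq[OF D] L_def
    using X by (auto simp: fun_eq_iff algebra_simps)
qed

end

section \<open>The Levi-Civita connection of the Heisenberg group\<close>

text \<open>The Christoffel symbols of \<open>heis_metric lam\<close> in the coordinates x, y, z,
  contracted with the tangent vectors \<open>u\<close> and \<open>v\<close>.\<close>

definition heis_christoffel :: "real \<Rightarrow> real^3 \<Rightarrow> real^3 \<Rightarrow> real^3 \<Rightarrow> real^3" where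
  "heis_christoffel lam p u v = vector
    [- lam\<^sup>2 * p $ 1 * (u $ 2 * v $ 2) - lam\<^sup>2 / 2 * (u $ 2 * v $ 3 + u $ 3 * v $ 2),
     p $ 1 / 2 * (u $ 1 * v $ 2 + u $ 2 * v $ 1) + (u $ 1 * v $ 3 + u $ 3 * v $ 1) / 2,
     (1 - (p $ 1)\<^sup>2) / 2 * (u $ 1 * v $ 2 + u $ 2 * v $ 1)
       - p $ 1 / 2 * (u $ 1 * v $ 3 + u $ 3 * v $ 1)]"

definition heis_connection :: "real \<Rightarrow> (real^3) vfield \<Rightarrow> (real^3) vfield \<Rightarrow> (real^3) vfield" where
  "heis_connection lam Y Z =
    (if smooth Y \<and> smooth Z
     then \<lambda>p. deriv_along Y Z p + heis_christoffel lam p (Y p) (Z p) else (\<lambda>p. 0))"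

lemma smooth_heis_christoffel:
  assumes "smooth Y" "smooth Z"
  shows "smooth (\<lambda>p. heis_christoffel lam p (Y p) (Z p))"
proof (rule smooth_vec)
  have "\<forall>i. smooth (\<lambda>p. heis_christoffel lam p (Y p) (Z p) $ i)"
    unfolding forall_3 heis_christoffel_def vector_3 power2_eq_square divide_inverse
    by (intro conjI smooth_intros assms)
  then show "smooth (\<lambda>p. heis_christoffel lam p (Y p) (Z p) $ i)" for i
    by blast
qed

lemma heis_christoffel_bilinear:
  "heis_christoffel lam p (u + u') v = heis_christoffel lam p u v + heis_christoffel lam p u' v"
  "heis_christoffel lam p (c *\<^sub>R u) v = c *\<^sub>R heis_christoffel lam p u v"
  "heis_christoffel lam p u (v + v') = heis_christoffel lam p u v + heis_christoffel lam p u v'"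
  "heis_christoffel lam p u (c *\<^sub>R v) = c *\<^sub>R heis_christoffel lam p u v"
  by (simp_all add: vec_eq_iff forall_3 heis_christoffel_def field_simps)

lemma heis_christoffel_commute: "heis_christoffel lam p u v = heis_christoffel lam p v u"
  by (simp add: vec_eq_iff forall_3 heis_christoffel_def algebra_simps)

lemma affine_connection_heis: "affine_connection (heis_connection lam)"
  unfolding affine_connection_def
  by (auto simp: heis_connection_def smooth_intros smooth_deriv_along smooth_heis_christoffel
      deriv_along_add_field deriv_along_add deriv_along_scaleR_field deriv_along_scaleR
      heis_christoffel_bilinear algebra_simps)

lemma torsion_free_heis: "torsion_free (heis_connection lam)"
  unfolding torsion_free_def
  by (auto simp: heis_connection_def lie_bracket_def heis_christoffel_commute)

text \<open>The last summand is the derivative of the metric coefficients along \<open>Y\<close>.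
  They vary only through the form x dy + dz, whose coefficients have x-derivative dy.\<close>

lemma deriv_along_heis_metric:
  assumes "smooth Z" "smooth W"
  shows "deriv_along Y (\<lambda>q. heis_metric lam q (Z q) (W q)) p =
    heis_metric lam p (deriv_along Y Z p) (W p) + heis_metric lam p (Z p) (deriv_along Y W p)
    + Y p $ 1 * (Z p $ 2 * (p $ 1 * W p $ 2 + W p $ 3) + (p $ 1 * Z p $ 2 + Z p $ 3) * W p $ 2)"
  unfolding heis_metric_def
  by (simp only: assms smooth_intros deriv_along_add deriv_along_mult deriv_along_nth
      deriv_along_const deriv_along_ident) (simp add: algebra_simps)

lemma metric_compatible_heis:
  assumes "lam > 0"
  shows "metric_compatible (heis_metric lam) (heis_connection lam)"
  unfolding metric_compatible_def
proof (intro allI impI)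
  fix Y Z W :: "(real^3) vfield" and p
  assume s: "smooth Y \<and> smooth Z \<and> smooth W"
  \<comment> \<open>Terms with differentiated fields match on both sides of the compatibility
    equation; what is left is this pointwise identity defining the Christoffel symbols.\<close>
  have "Y p $ 1 * (Z p $ 2 * (p $ 1 * W p $ 2 + W p $ 3) + (p $ 1 * Z p $ 2 + Z p $ 3) * W p $ 2)
    = heis_metric lam p (heis_christoffel lam p (Y p) (Z p)) (W p)
    + heis_metric lam p (Z p) (heis_christoffel lam p (Y p) (W p))"
    using assms by (simp add: heis_metric_def heis_christoffel_def field_simps power2_eq_square)
  with s show "deriv_along Y (\<lambda>q. heis_metric lam q (Z q) (W q)) p
      = heis_metric lam p (heis_connection lam Y Z p) (W p)
      + heis_metric lam p (Z p) (heis_connection lam Y W p)"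
    by (simp add: deriv_along_heis_metric heis_connection_def)
      (simp add: heis_metric_def algebra_simps)
qed

lemma smooth_metric_heis:
  assumes "lam > 0"
  shows "smooth_metric (heis_metric lam)"
proof
  fix p u :: "real^3"
  assume u: "\<And>v. heis_metric lam p u v = 0"
  have 1: "u $ 1 = 0" using u[of "axis 1 1"] assms by (simp add: heis_metric_def axis_def)
  have 3: "p $ 1 * u $ 2 + u $ 3 = 0" using u[of "axis 3 1"] assms by (simp add: heis_metric_def axis_def)
  have 2: "u $ 2 = 0" using u[of "axis 2 1"] 3 assms by (simp add: heis_metric_def axis_def)
  show "u = 0" using 1 2 3 by (simp add: vec_eq_iff forall_3)
qed (auto simp: heis_metric_def divide_inverse algebra_simps intro!: smooth_intros)

lemma levi_civita_heis: "lam > 0 \<Longrightarrow> levi_civita (heis_metric lam) = heis_connection lam"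
  using smooth_metric.levi_civita_eq smooth_metric_heis affine_connection_heis torsion_free_heis
    metric_compatible_heis by blast

section \<open>Affine fields in a frame with constant coefficients\<close>

lemma affine_connectionD:
  fixes f :: "'a::euclidean_space \<Rightarrow> real"
  assumes "affine_connection D" "smooth f" "smooth Y" "smooth Y'" "smooth Z" "smooth Z'"
  shows "D (\<lambda>p. Y p + Y' p) Z = (\<lambda>p. D Y Z p + D Y' Z p)"
    and "D (\<lambda>p. f p *\<^sub>R Y p) Z = (\<lambda>p. f p *\<^sub>R D Y Z p)"
    and "D Y (\<lambda>p. Z p + Z' p) = (\<lambda>p. D Y Z p + D Y Z' p)"
    and "D Y (\<lambda>p. f p *\<^sub>R Z p) = (\<lambda>p. deriv_along Y f p *\<^sub>R Z p + f p *\<^sub>R D Y Z p)"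
  using assms unfolding affine_connection_def by blast+

lemma affine_connection_zero_left:
  assumes "affine_connection D" "smooth Z"
  shows "D (\<lambda>p. 0) Z = (\<lambda>p. 0)"
  using affine_connectionD(1)[of D "\<lambda>p. 0" "\<lambda>p. 0" "\<lambda>p. 0" Z Z] assms
  by (simp add: fun_eq_iff)

lemma affine_connection_zero_right:
  assumes "affine_connection D" "smooth Y"
  shows "D Y (\<lambda>p. 0) = (\<lambda>p. 0)"
  using affine_connectionD(3)[of D "\<lambda>p. 0" Y Y "\<lambda>p. 0" "\<lambda>p. 0"] assms
  by (simp add: fun_eq_iff)

lemma affine_connection_sum_left:
  assumes D: "affine_connection D" and Z: "smooth Z"
    and h: "\<And>m. smooth (h m)" and E: "\<And>m. smooth (E m)"
  shows "D (\<lambda>p. \<Sum>m\<in>A. h m p *\<^sub>R E m p) Z = (\<lambda>p. \<Sum>m\<in>A. h m p *\<^sub>R D (E m) Z p)"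
proof (induction A rule: infinite_finite_induct)
  case (insert x A)
  have "D (\<lambda>p. h x p *\<^sub>R E x p + (\<Sum>m\<in>A. h m p *\<^sub>R E m p)) Z
      = (\<lambda>p. D (\<lambda>p. h x p *\<^sub>R E x p) Z p + D (\<lambda>p. \<Sum>m\<in>A. h m p *\<^sub>R E m p) Z p)"
    by (intro affine_connectionD(1)[OF D, of "\<lambda>p. 0" _ _ Z Z]
        smooth_scaleR smooth_sum Z h E smooth_const)
  moreover have "D (\<lambda>p. h x p *\<^sub>R E x p) Z = (\<lambda>p. h x p *\<^sub>R D (E x) Z p)"
    by (intro affine_connectionD(2)[OF D, of _ _ Z Z Z] Z h E)
  ultimately show ?case
    using insert by simp
qed (simp_all add: affine_connection_zero_left[OF D Z])

lemma affine_connection_sum_right: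
  assumes D: "affine_connection D" and Y: "smooth Y"
    and h: "\<And>m. smooth (h m)" and E: "\<And>m. smooth (E m)"
  shows "D Y (\<lambda>p. \<Sum>m\<in>A. h m p *\<^sub>R E m p)
    = (\<lambda>p. \<Sum>m\<in>A. deriv_along Y (h m) p *\<^sub>R E m p + h m p *\<^sub>R D Y (E m) p)"
proof (induction A rule: infinite_finite_induct)
  case (insert x A)
  have "D Y (\<lambda>p. h x p *\<^sub>R E x p + (\<Sum>m\<in>A. h m p *\<^sub>R E m p))
      = (\<lambda>p. D Y (\<lambda>p. h x p *\<^sub>R E x p) p + D Y (\<lambda>p. \<Sum>m\<in>A. h m p *\<^sub>R E m p) p)"
    by (intro affine_connectionD(3)[OF D, of "\<lambda>p. 0" Y Y]
        smooth_scaleR smooth_sum Y h E smooth_const)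
  moreover have "D Y (\<lambda>p. h x p *\<^sub>R E x p)
      = (\<lambda>p. deriv_along Y (h x) p *\<^sub>R E x p + h x p *\<^sub>R D Y (E x) p)"
    by (intro affine_connectionD(4)[OF D, of _ Y Y _ Y] Y h E)
  ultimately show ?case
    using insert by simp
qed (simp_all add: affine_connection_zero_right[OF D Y])

text \<open>In a frame with constant connection coefficients \<open>G\<close>, the matrix \<open>A\<close> of
  \<open>Y \<mapsto> - [X, Y]\<close> for an affine field \<open>X\<close> has derivative \<open>frame_deriv G i A\<close> along the
  \<open>i\<close>-th frame field.\<close>

definition frame_deriv ::
  "('i::finite \<Rightarrow> 'i \<Rightarrow> 'i \<Rightarrow> real) \<Rightarrow> 'i \<Rightarrow> ('i \<Rightarrow> 'i \<Rightarrow> real) \<Rightarrow> 'i \<Rightarrow> 'i \<Rightarrow> real" where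
  "frame_deriv G i A j k =
    (\<Sum>m\<in>UNIV. G i j m * A m k - A i m * G m j k - A j m * G i m k)"

text \<open>The model is a left-invariant frame on a Lie group with left-invariant connection. The
  assumption \<open>independent\<close> allows coefficients to be compared.\<close>

locale constant_frame =
  fixes D :: "'a::euclidean_space vfield \<Rightarrow> 'a vfield \<Rightarrow> 'a vfield"
    and E :: "'i::finite \<Rightarrow> 'a vfield"
    and G C :: "'i \<Rightarrow> 'i \<Rightarrow> 'i \<Rightarrow> real"
  assumes connection: "affine_connection D"
    and smooth_frame: "smooth (E i)"
    and independent: "(\<Sum>m\<in>UNIV. c m *\<^sub>R E m p) = 0 \<Longrightarrow> c k = 0"
    and frame_connection: "D (E i) (E j) = (\<lambda>p. \<Sum>m\<in>UNIV. G i j m *\<^sub>R E m p)"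
    and frame_bracket: "lie_bracket (E i) (E j) = (\<lambda>p. \<Sum>m\<in>UNIV. C i j m *\<^sub>R E m p)"
begin

text \<open>The component along \<open>E k\<close> of \<open>[E i, X]\<close> for the field
  \<open>X\<close> with frame components \<open>f\<close>. This sign lets the derivative of
  \<open>f k\<close> enter positively.\<close>

definition bracket_matrix :: "('i \<Rightarrow> 'a \<Rightarrow> real) \<Rightarrow> 'i \<Rightarrow> 'i \<Rightarrow> 'a \<Rightarrow> real" where
  "bracket_matrix f i k p = deriv_along (E i) (f k) p - (\<Sum>l\<in>UNIV. f l p * C l i k)"

lemma smooth_bracket_matrix:
  assumes "\<And>i. smooth (f i)"
  shows "smooth (bracket_matrix f i k)"
  unfolding bracket_matrix_def[abs_def]
  by (intro smooth_diff smooth_sum smooth_mult smooth_const smooth_deriv_along smooth_frame assms)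

lemma lie_bracket_frame:
  assumes "\<And>i. smooth (f i)"
  shows "lie_bracket (\<lambda>p. \<Sum>m\<in>UNIV. f m p *\<^sub>R E m p) (E i) p
    = (\<Sum>k\<in>UNIV. - bracket_matrix f i k p *\<^sub>R E k p)"
proof -
  have s: "smooth (\<lambda>p. f m p *\<^sub>R E m p)" for m
    by (intro smooth_scaleR assms smooth_frame)
  have "lie_bracket (\<lambda>p. \<Sum>m\<in>UNIV. f m p *\<^sub>R E m p) (E i) p
      = (\<Sum>m\<in>UNIV. f m p *\<^sub>R deriv_along (E m) (E i) p
          - (deriv_along (E i) (f m) p *\<^sub>R E m p + f m p *\<^sub>R deriv_along (E i) (E m) p))"
    unfolding lie_bracket_def
    by (simp add: deriv_along_sum_field deriv_along_sum deriv_along_scaleR_field deriv_along_scaleR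
        s assms smooth_frame sum_subtractf)
  also have "\<dots> = (\<Sum>m\<in>UNIV. f m p *\<^sub>R lie_bracket (E m) (E i) p - deriv_along (E i) (f m) p *\<^sub>R E m p)"
    by (simp add: lie_bracket_def algebra_simps)
  also have "\<dots> = (\<Sum>m\<in>UNIV. \<Sum>k\<in>UNIV. (f m p * C m i k) *\<^sub>R E k p)
      - (\<Sum>k\<in>UNIV. deriv_along (E i) (f k) p *\<^sub>R E k p)"
    by (simp add: frame_bracket sum_subtractf scaleR_sum_right)
  also have "(\<Sum>m\<in>UNIV. \<Sum>k\<in>UNIV. (f m p * C m i k) *\<^sub>R E k p)
      = (\<Sum>k\<in>UNIV. (\<Sum>m\<in>UNIV. f m p * C m i k) *\<^sub>R E k p)"
    by (subst sum.swap) (simp add: scaleR_sum_left)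
  finally show ?thesis
    by (simp add: bracket_matrix_def sum_subtractf[symmetric] algebra_simps)
qed

text \<open>In the affine equation on frame fields, only the covariant derivative of
  \<open>[X, E j]\<close> differentiates the matrix, through the Leibniz rule. All other terms are
  algebraic in it, so comparing frame coefficients solves for the derivative.\<close>

lemma deriv_bracket_matrix:
  assumes f: "\<And>i. smooth (f i)"
    and X: "X = (\<lambda>p. \<Sum>m\<in>UNIV. f m p *\<^sub>R E m p)"
    and affine: "\<And>i j. lie_bracket X (D (E i) (E j))
      = (\<lambda>p. D (lie_bracket X (E i)) (E j) p + D (E i) (lie_bracket X (E j)) p)"
  shows "deriv_along (E i) (bracket_matrix f j k) p
    = frame_deriv G i (\<lambda>j k. bracket_matrix f j k p) j k"
proof -
  let ?M = "bracket_matrix f"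
  have sM: "smooth (?M i k)" "smooth (\<lambda>p. - ?M i k p)" for i k
    by (intro smooth_minus smooth_bracket_matrix f)+
  have sX: "smooth X"
    unfolding X by (intro smooth_sum smooth_scaleR f smooth_frame)
  have XE: "lie_bracket X (E i) = (\<lambda>p. \<Sum>k\<in>UNIV. - ?M i k p *\<^sub>R E k p)" for i
    unfolding X by (intro ext lie_bracket_frame f)
  have swap: "(\<Sum>m\<in>UNIV. a m *\<^sub>R (\<Sum>k\<in>UNIV. b m k *\<^sub>R E k p))
      = (\<Sum>k\<in>UNIV. (\<Sum>m\<in>UNIV. a m * b m k) *\<^sub>R E k p)" for a :: "'i \<Rightarrow> real" and b
    unfolding scaleR_sum_right scaleR_sum_left by (subst sum.swap) simp
  have "lie_bracket X (D (E i) (E j)) p = (\<Sum>m\<in>UNIV. G i j m *\<^sub>R lie_bracket X (E m) p)"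
    unfolding frame_connection lie_bracket_def
    by (simp add: deriv_along_sum_field deriv_along_sum deriv_along_scaleR_field
        deriv_along_scaleR smooth_scaleR smooth_frame sX scaleR_diff_right sum_subtractf)
  also have "\<dots> = (\<Sum>k\<in>UNIV. (\<Sum>m\<in>UNIV. G i j m * - ?M m k p) *\<^sub>R E k p)"
    unfolding XE swap ..
  finally have 1: "lie_bracket X (D (E i) (E j)) p = \<dots>" .
  have "D (lie_bracket X (E i)) (E j) p = (\<Sum>m\<in>UNIV. - ?M i m p *\<^sub>R D (E m) (E j) p)"
    unfolding XE by (simp only: affine_connection_sum_left[OF connection smooth_frame sM(2) smooth_frame])
  also have "\<dots> = (\<Sum>k\<in>UNIV. (\<Sum>m\<in>UNIV. - ?M i m p * G m j k) *\<^sub>R E k p)"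
    unfolding frame_connection swap ..
  finally have 2: "D (lie_bracket X (E i)) (E j) p = \<dots>" .
  have dM: "deriv_along Y (\<lambda>p. - ?M j m p) p = - deriv_along Y (?M j m) p" for Y m
    by (rule deriv_along_linear[OF bounded_linear_minus[OF bounded_linear_ident] sM(1)])
  have "D (E i) (lie_bracket X (E j)) p
      = (\<Sum>m\<in>UNIV. - deriv_along (E i) (?M j m) p *\<^sub>R E m p)
      + (\<Sum>m\<in>UNIV. - ?M j m p *\<^sub>R D (E i) (E m) p)"
    unfolding XE
    by (simp only: affine_connection_sum_right[OF connection smooth_frame sM(2) smooth_frame]
        dM sum.distrib)
  also have "(\<Sum>m\<in>UNIV. - ?M j m p *\<^sub>R D (E i) (E m) p)
      = (\<Sum>k\<in>UNIV. (\<Sum>m\<in>UNIV. - ?M j m p * G i m k) *\<^sub>R E k p)"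
    unfolding frame_connection swap ..
  finally have 3: "D (E i) (lie_bracket X (E j)) p
      = (\<Sum>m\<in>UNIV. - deriv_along (E i) (?M j m) p *\<^sub>R E m p) + \<dots>" .
  have "(\<Sum>k\<in>UNIV. ((\<Sum>m\<in>UNIV. G i j m * - ?M m k p) - ((\<Sum>m\<in>UNIV. - ?M i m p * G m j k)
      + (- deriv_along (E i) (?M j k) p + (\<Sum>m\<in>UNIV. - ?M j m p * G i m k)))) *\<^sub>R E k p) = 0"
    using fun_cong[OF affine[of i j], of p] unfolding 1 2 3
    by (simp only: scaleR_diff_left scaleR_add_left sum_subtractf sum.distrib diff_self)
  from independent[OF this, of k] show ?thesis
    by (simp add: frame_deriv_def sum_negf sum_subtractf sum.distrib algebra_simps)
qed

text \<open>Since \<open>frame_deriv G l\<close> is linear with constant coefficients,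
  differentiation passes to the entries. The later derivative thus becomes the inner operator, which
  reverses the order.\<close>

lemma deriv_frame_deriv:
  assumes sM: "\<And>j k. smooth (M j k)"
    and M: "\<And>i j k p. deriv_along (E i) (M j k) p = frame_deriv G i (\<lambda>j k. M j k p) j k"
  shows "deriv_along (E i) (\<lambda>p. frame_deriv G l (\<lambda>j k. M j k p) j k) p
    = frame_deriv G l (frame_deriv G i (\<lambda>j k. M j k p)) j k"
  unfolding frame_deriv_def[of G l]
  by (simp add: deriv_along_sum deriv_along_diff deriv_along_mult smooth_diff smooth_mult sM M)

text \<open>The integrability conditions of the system \<open>E\<^sub>i M = frame_deriv G i M\<close>.\<close>

lemma frame_integrability:
  assumes sM: "\<And>j k. smooth (M j k)"
    and M: "\<And>i j k p. deriv_along (E i) (M j k) p = frame_deriv G i (\<lambda>j k. M j k p) j k"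
  shows "frame_deriv G l (frame_deriv G i (\<lambda>j k. M j k p)) j k
      - frame_deriv G i (frame_deriv G l (\<lambda>j k. M j k p)) j k
    = (\<Sum>m\<in>UNIV. C i l m * frame_deriv G m (\<lambda>j k. M j k p) j k)"
proof -
  have M': "deriv_along (E i) (M j k) = (\<lambda>p. frame_deriv G i (\<lambda>j k. M j k p) j k)" for i j k
    using M by blast
  \<comment> \<open>The derivative along \<open>[E i, E l]\<close> is computed twice: as a
    commutator, and by expanding the bracket in the frame.\<close>
  have "deriv_along (lie_bracket (E i) (E l)) (M j k) p
      = frame_deriv G l (frame_deriv G i (\<lambda>j k. M j k p)) j k
      - frame_deriv G i (frame_deriv G l (\<lambda>j k. M j k p)) j k"
    by (simp add: deriv_along_lie_bracket[OF smooth_frame smooth_frame sM] M'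
        deriv_frame_deriv[OF sM M])
  moreover have "deriv_along (lie_bracket (E i) (E l)) (M j k) p
      = (\<Sum>m\<in>UNIV. C i l m * frame_deriv G m (\<lambda>j k. M j k p) j k)"
    by (simp add: frame_bracket deriv_along_sum_field deriv_along_scaleR_field sM M')
  ultimately show ?thesis by simp
qed

end

section \<open>Affine vector fields on the Heisenberg group\<close>

definition heis_frame :: "real \<Rightarrow> 3 \<Rightarrow> (real^3) vfield" where
  "heis_frame lam i = (if i = 1 then heis_e1 else if i = 2 then heis_e2 lam else heis_e3)"

definition heis_structure :: "real \<Rightarrow> 3 \<Rightarrow> 3 \<Rightarrow> 3 \<Rightarrow> real" where
  "heis_structure lam i j k =
    (if i = 1 \<and> j = 2 \<and> k = 3 then lam else if i = 2 \<and> j = 1 \<and> k = 3 then - lam else 0)"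

text \<open>The Koszul formula in an orthonormal frame with constant structure coefficients.\<close>

definition heis_coeff :: "real \<Rightarrow> 3 \<Rightarrow> 3 \<Rightarrow> 3 \<Rightarrow> real" where
  "heis_coeff lam i j k =
    (heis_structure lam i j k - heis_structure lam j k i + heis_structure lam k i j) / 2"

lemma heis_frame_nth [simp]:
  "heis_e1 p $ 1 = 0" "heis_e1 p $ 2 = 1" "heis_e1 p $ 3 = - p $ 1"
  "heis_e2 lam p $ 1 = lam" "heis_e2 lam p $ 2 = 0" "heis_e2 lam p $ 3 = 0"
  "heis_e3 p $ 1 = 0" "heis_e3 p $ 2 = 0" "heis_e3 p $ 3 = 1"
  by (simp_all add: heis_e1_def heis_e2_def heis_e3_def)

lemma smooth_heis_frame: "smooth heis_e1" "smooth (heis_e2 lam)" "smooth heis_e3"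
proof -
  have "smooth F" if "\<forall>i. smooth (\<lambda>p. F p $ i)" for F :: "(real^3) vfield"
    using that smooth_vec by blast
  then show "smooth heis_e1" "smooth (heis_e2 lam)" "smooth heis_e3"
    by (simp_all add: forall_3 smooth_intros)
qed

lemma deriv_along_heis_frame:
  "deriv_along Y heis_e1 p = vector [0, 0, - Y p $ 1]"
  "deriv_along Y (heis_e2 lam) p = 0"
  "deriv_along Y heis_e3 p = 0"
proof -
  have *: "deriv_along Y F p = v" if "smooth F" "\<forall>i. deriv_along Y (\<lambda>p. F p $ i) p = v $ i"
    for F :: "(real^3) vfield" and v
    using that by (simp add: vec_eq_iff deriv_along_nth)
  have d: "deriv_along Y (\<lambda>p. - p $ 1) p = - Y p $ 1"
    by (subst deriv_along_linear[OF bounded_linear_minus[OF bounded_linear_ident]])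
      (simp_all add: smooth_intros deriv_along_nth)
  show "deriv_along Y heis_e1 p = vector [0, 0, - Y p $ 1]"
    "deriv_along Y (heis_e2 lam) p = 0" "deriv_along Y heis_e3 p = 0"
    by (rule *; simp add: smooth_heis_frame forall_3 d)+
qed

lemma constant_frame_heis:
  assumes "lam > 0"
  shows "constant_frame (heis_connection lam) (heis_frame lam) (heis_coeff lam) (heis_structure lam)"
proof
  show "affine_connection (heis_connection lam)"
    by (rule affine_connection_heis)
  show s: "smooth (heis_frame lam i)" for i
    by (simp add: heis_frame_def smooth_heis_frame)
  show "c k = 0" if "(\<Sum>m\<in>UNIV. c m *\<^sub>R heis_frame lam m p) = 0" for c k p
  proof -
    have "c 1 = 0 \<and> c 2 = 0 \<and> c 3 = 0"
      using that assms by (auto simp: sum_3 vec_eq_iff forall_3 heis_frame_def)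
    then show ?thesis using exhaust_3[of k] by auto
  qed
  have "\<forall>i j. lie_bracket (heis_frame lam i) (heis_frame lam j) p
      = (\<Sum>m\<in>UNIV. heis_structure lam i j m *\<^sub>R heis_frame lam m p)" for p
    by (simp add: forall_3 sum_3 lie_bracket_def heis_frame_def deriv_along_heis_frame
        heis_structure_def vec_eq_iff)
  then show "lie_bracket (heis_frame lam i) (heis_frame lam j)
      = (\<lambda>p. \<Sum>m\<in>UNIV. heis_structure lam i j m *\<^sub>R heis_frame lam m p)" for i j
    by blast
  have "\<forall>i j. heis_connection lam (heis_frame lam i) (heis_frame lam j) p
      = (\<Sum>m\<in>UNIV. heis_coeff lam i j m *\<^sub>R heis_frame lam m p)" for p
    using assms
    by (simp add: forall_3 sum_3 heis_connection_def heis_frame_def deriv_along_heis_frame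
        heis_christoffel_def smooth_heis_frame
        heis_structure_def heis_coeff_def vec_eq_iff power2_eq_square field_simps)
  then show "heis_connection lam (heis_frame lam i) (heis_frame lam j)
      = (\<lambda>p. \<Sum>m\<in>UNIV. heis_coeff lam i j m *\<^sub>R heis_frame lam m p)" for i j
    by blast
qed

text \<open>All coefficients are multiples of \<open>lam\<close>, so each condition is lam^2 times a
  linear relation between entries of \<open>A\<close>, and one choice of indices suffices for each
  claim. The rotation in the e_1, e_2 plane preserves the curvature, which is why
  \<open>A 1 2\<close> stays free.\<close>

lemma heis_integrability_solution:
  assumes "lam > 0"
    and "\<And>i l j k. frame_deriv (heis_coeff lam) l (frame_deriv (heis_coeff lam) i A) j k
      - frame_deriv (heis_coeff lam) i (frame_deriv (heis_coeff lam) l A) j k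
      = (\<Sum>m\<in>UNIV. heis_structure lam i l m * frame_deriv (heis_coeff lam) m A j k)"
  shows "A 1 1 = 0" "A 2 2 = 0" "A 3 3 = 0" "A 2 3 = 0" "A 1 3 = 0" "A 3 2 = 0" "A 3 1 = 0"
    "A 2 1 = - A 1 2"
proof -
  have z: "x = 0" if "lam * (lam * x) = 0" for x
    using that assms(1) by simp
  note simps = frame_deriv_def sum_3 heis_coeff_def heis_structure_def
  show "A 1 1 = 0" using assms(2)[of 2 1 1 2] by - (rule z, simp add: simps field_simps)
  show "A 2 2 = 0" using assms(2)[of 2 1 2 1] by - (rule z, simp add: simps field_simps)
  show "A 3 3 = 0" using assms(2)[of 3 1 3 1] by - (rule z, simp add: simps field_simps)
  show "A 2 3 = 0" using assms(2)[of 2 1 1 3] by - (rule z, simp add: simps field_simps)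
  show "A 1 3 = 0" using assms(2)[of 2 1 2 3] by - (rule z, simp add: simps field_simps)
  show "A 3 2 = 0" using assms(2)[of 3 1 1 2] by - (rule z, simp add: simps field_simps)
  show "A 3 1 = 0" using assms(2)[of 3 2 2 1] by - (rule z, simp add: simps field_simps)
  show "A 2 1 = - A 1 2" using assms(2)[of 3 1 2 3] z[of "A 1 2 + A 2 1"] by (simp add: simps field_simps)
qed

lemma deriv_along_heis_frame_zero_imp_const:
  fixes h :: "real^3 \<Rightarrow> real"
  assumes "lam > 0" "smooth h"
    and e1: "\<And>p. deriv_along heis_e1 h p = 0"
    and e2: "\<And>p. deriv_along (heis_e2 lam) h p = 0"
    and e3: "\<And>p. deriv_along heis_e3 h p = 0"
  shows "\<exists>c. \<forall>p. h p = c"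
proof -
  have "frechet_derivative h (at p) v = 0" for p v
  proof -
    \<comment> \<open>The coefficients are the values on \<open>v\<close> of the dual coframe dy,
      dx/lam, x dy + dz.\<close>
    have "v = v $ 2 *\<^sub>R heis_e1 p + (v $ 1 / lam) *\<^sub>R heis_e2 lam p
        + (v $ 3 + p $ 1 * v $ 2) *\<^sub>R heis_e3 p" (is "v = ?w")
      using assms(1) by (simp add: vec_eq_iff forall_3)
    moreover have "frechet_derivative h (at p) ?w = 0"
      using e1[of p] e2[of p] e3[of p] linear_smooth_derivative[OF assms(2), of p]
      by (simp add: deriv_along_def linear_add linear_scale)
    ultimately show ?thesis by simp
  qed
  then have "frechet_derivative h (at p) = (\<lambda>v. 0)" for p
    by blast
  then have "(h has_derivative (\<lambda>v. 0)) (at p)" for p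
    using smooth_has_derivative[OF assms(2), of p] by simp
  then show ?thesis
    using has_derivative_zero_constant[of UNIV h] by auto
qed

lemma affine_imp_frame_derivatives:
  assumes lam: "lam > 0" and f: "smooth f1" "smooth f2" "smooth f3"
    and affine: "affine_vector_field (heis_metric lam)
      (\<lambda>p. f1 p *\<^sub>R heis_e1 p + f2 p *\<^sub>R heis_e2 lam p + f3 p *\<^sub>R heis_e3 p)"
  shows "\<exists>m. \<forall>p.
    deriv_along heis_e1 f1 p = 0 \<and> deriv_along (heis_e2 lam) f1 p = - m \<and> deriv_along heis_e3 f1 p = 0 \<and>
    deriv_along heis_e1 f2 p = m \<and> deriv_along (heis_e2 lam) f2 p = 0 \<and> deriv_along heis_e3 f2 p = 0 \<and>
    deriv_along heis_e1 f3 p = - lam * f2 p \<and> deriv_along (heis_e2 lam) f3 p = lam * f1 p \<and>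
    deriv_along heis_e3 f3 p = 0"
proof -
  interpret constant_frame "heis_connection lam" "heis_frame lam" "heis_coeff lam" "heis_structure lam"
    by (rule constant_frame_heis[OF lam])
  define f :: "3 \<Rightarrow> real^3 \<Rightarrow> real" where
    "f i = (if i = 1 then f1 else if i = 2 then f2 else f3)" for i
  have sf: "smooth (f i)" for i using f by (simp add: f_def)
  let ?X = "\<lambda>p. f1 p *\<^sub>R heis_e1 p + f2 p *\<^sub>R heis_e2 lam p + f3 p *\<^sub>R heis_e3 p"
  define A where "A = bracket_matrix f"
  have sA: "smooth (A i k)" for i k
    unfolding A_def by (rule smooth_bracket_matrix[OF sf])
  have dA: "deriv_along (heis_frame lam i) (A j k) p
      = frame_deriv (heis_coeff lam) i (\<lambda>j k. A j k p) j k" for i j k p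
    unfolding A_def
  proof (rule deriv_bracket_matrix[OF sf])
    show "?X = (\<lambda>p. \<Sum>m\<in>UNIV. f m p *\<^sub>R heis_frame lam m p)"
      by (simp add: sum_3 f_def heis_frame_def)
    show "lie_bracket ?X (heis_connection lam (heis_frame lam i) (heis_frame lam j))
      = (\<lambda>p. heis_connection lam (lie_bracket ?X (heis_frame lam i)) (heis_frame lam j) p
        + heis_connection lam (heis_frame lam i) (lie_bracket ?X (heis_frame lam j)) p)" for i j
      using affine smooth_frame unfolding affine_vector_field_def levi_civita_heis[OF lam] by blast
  qed
  note A = heis_integrability_solution[OF lam frame_integrability[OF sA dA]]
  \<comment> \<open>Once \<open>A\<close> is known to be a multiple of the rotation, the system
    itself makes the remaining entry constant; its value is the witness \<open>m\<close>.\<close>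
  have "deriv_along (heis_frame lam i) (A 1 2) p = 0" for i p
    unfolding dA using exhaust_3[of i]
    by (auto simp: frame_deriv_def sum_3 A heis_coeff_def heis_structure_def)
  from this[of 1] this[of 2] this[of 3] obtain m where m: "A 1 2 p = m" for p
    using deriv_along_heis_frame_zero_imp_const[OF lam sA, of 1 2]
    unfolding heis_frame_def by auto
  have Ap: "A i k p = deriv_along (heis_frame lam i) (f k) p
      - (\<Sum>l\<in>UNIV. f l p * heis_structure lam l i k)" for i k p
    by (simp add: A_def bracket_matrix_def)
  \<comment> \<open>These nine values are the claimed equations. Brackets have only an e_3
    component, so structure terms appear only in the third column and couple \<open>f3\<close> to
    \<open>f1\<close> and \<open>f2\<close>.\<close>
  have "A 1 1 p = 0 \<and> A 2 1 p = - m \<and> A 3 1 p = 0 \<and> A 1 2 p = m \<and> A 2 2 p = 0 \<and> A 3 2 p = 0 \<and>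
    A 1 3 p = 0 \<and> A 2 3 p = 0 \<and> A 3 3 p = 0" for p
    by (simp add: A m)
  note this[unfolded Ap]
  then show ?thesis
    by (intro exI[of _ m]) (simp add: sum_3 heis_structure_def f_def heis_frame_def eq_neg_iff_add_eq_0 mult.commute)
qed

section \<open>Integration of the frame equations, and the converse\<close>

lemmas coordinate_derivs =
  deriv_along_add deriv_along_diff deriv_along_mult deriv_along_nth
  deriv_along_const deriv_along_ident smooth_intros

lemma affine_imp_explicit:
  assumes lam: "lam > 0" and f: "smooth f1" "smooth f2" "smooth f3"
    and affine: "affine_vector_field (heis_metric lam)
      (\<lambda>p. f1 p *\<^sub>R heis_e1 p + f2 p *\<^sub>R heis_e2 lam p + f3 p *\<^sub>R heis_e3 p)"
  shows "\<exists>c1 c2 c3 c4. \<forall>p. f1 p = c1 * p $ 1 + c2 \<and> f2 p = - lam * c1 * p $ 2 + c3 \<and>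
    f3 p = lam\<^sup>2 * c1 / 2 * (p $ 2)\<^sup>2 + c1 / 2 * (p $ 1)\<^sup>2 + c2 * p $ 1 - lam * c3 * p $ 2 + c4"
proof -
  obtain m where m: "\<And>p. deriv_along heis_e1 f1 p = 0" "\<And>p. deriv_along (heis_e2 lam) f1 p = - m"
    "\<And>p. deriv_along heis_e3 f1 p = 0"
    "\<And>p. deriv_along heis_e1 f2 p = m" "\<And>p. deriv_along (heis_e2 lam) f2 p = 0"
    "\<And>p. deriv_along heis_e3 f2 p = 0"
    "\<And>p. deriv_along heis_e1 f3 p = - lam * f2 p" "\<And>p. deriv_along (heis_e2 lam) f3 p = lam * f1 p"
    "\<And>p. deriv_along heis_e3 f3 p = 0"
    using affine_imp_frame_derivatives[OF assms] by blast
  \<comment> \<open>The slope of \<open>f1\<close> in x: its derivative along e_2, which is lam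
    times the x-derivative, equals \<open>- m\<close>.\<close>
  define c1 where "c1 = - m / lam"
  have m_eq: "m = - lam * c1" using lam by (simp add: c1_def)
  have "\<exists>c. \<forall>p. f1 p - c1 * p $ 1 = c"
    by (rule deriv_along_heis_frame_zero_imp_const[OF lam];
        (simp only: coordinate_derivs f m)?; simp add: m_eq)
  then obtain c2 where c2: "\<And>p. f1 p = c1 * p $ 1 + c2"
    by (metis add.commute diff_add_cancel)
  have "\<exists>c. \<forall>p. f2 p - (- lam * c1) * p $ 2 = c"
    by (rule deriv_along_heis_frame_zero_imp_const[OF lam];
        (simp only: coordinate_derivs f m)?; simp add: m_eq)
  then obtain c3 where c3: "\<And>p. f2 p = - lam * c1 * p $ 2 + c3"
    by (metis add.commute diff_add_cancel)
  \<comment> \<open>As \<open>f3\<close> does not depend on z, its x- and y-derivatives are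
    \<open>f1\<close> and \<open>- lam * f2\<close>. These depend on x alone and y alone, so the
    polynomial is the sum of their antiderivatives.\<close>
  have "\<exists>c. \<forall>p. f3 p - (lam\<^sup>2 * c1 / 2 * (p $ 2 * p $ 2) + c1 / 2 * (p $ 1 * p $ 1) + c2 * p $ 1
      - lam * c3 * p $ 2) = c"
    by (rule deriv_along_heis_frame_zero_imp_const[OF lam];
        (simp only: coordinate_derivs f m)?; simp add: c2 c3 algebra_simps power2_eq_square)
  then obtain c4 where "\<And>p. f3 p = lam\<^sup>2 * c1 / 2 * (p $ 2)\<^sup>2 + c1 / 2 * (p $ 1)\<^sup>2 + c2 * p $ 1
      - lam * c3 * p $ 2 + c4"
    unfolding power2_eq_square by (metis add.commute diff_add_cancel)
  with c2 c3 show ?thesis by blast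
qed

text \<open>For \<open>c1 = 0\<close> these fields generate the left translations, which are
  isometries; \<open>c1\<close> adds an infinitesimal rotation about the origin. The Killing
  equation is checked directly in coordinates.\<close>

lemma explicit_imp_affine:
  assumes lam: "lam > 0" and f: "smooth f1" "smooth f2" "smooth f3"
    and f1: "\<And>p. f1 p = c1 * p $ 1 + c2" and f2: "\<And>p. f2 p = - lam * c1 * p $ 2 + c3"
    and f3: "\<And>p. f3 p = lam\<^sup>2 * c1 / 2 * (p $ 2)\<^sup>2 + c1 / 2 * (p $ 1)\<^sup>2 + c2 * p $ 1
      - lam * c3 * p $ 2 + c4"
  shows "affine_vector_field (heis_metric lam)
    (\<lambda>p. f1 p *\<^sub>R heis_e1 p + f2 p *\<^sub>R heis_e2 lam p + f3 p *\<^sub>R heis_e3 p)"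
    (is "affine_vector_field _ ?X")
proof (rule smooth_metric.killing_imp_affine[OF smooth_metric_heis affine_connection_heis
      torsion_free_heis metric_compatible_heis])
  show sX: "smooth ?X"
    by (intro smooth_intros f smooth_heis_frame)
  \<comment> \<open>The third coordinate component is \<open>f3\<close> minus x times
    \<open>f1\<close>, because e_1 contributes -x in the z direction. This cancels the
    \<open>c2\<close> term and reverses the sign of the quadratic term in x.\<close>
  have X: "?X p $ 1 = lam * (c3 - lam * c1 * p $ 2)" "?X p $ 2 = c1 * p $ 1 + c2"
    "?X p $ 3 = lam\<^sup>2 * c1 / 2 * (p $ 2 * p $ 2) - c1 / 2 * (p $ 1 * p $ 1) - lam * c3 * p $ 2 + c4" for p
    by (simp_all add: f1 f2 f3 power2_eq_square algebra_simps)
  have dX: "deriv_along V ?X p $ 1 = - lam\<^sup>2 * c1 * V p $ 2"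
    "deriv_along V ?X p $ 2 = c1 * V p $ 1"
    "deriv_along V ?X p $ 3 = lam\<^sup>2 * c1 * p $ 2 * V p $ 2 - c1 * p $ 1 * V p $ 1 - lam * c3 * V p $ 2"
    for V p
    unfolding deriv_along_nth[OF sX, symmetric] X
    by (simp_all only: coordinate_derivs) (simp_all add: power2_eq_square algebra_simps)
  fix Y Z :: "(real^3) vfield" and p
  assume s: "smooth Y" "smooth Z"
  \<comment> \<open>After the derivatives of \<open>Y\<close> and \<open>Z\<close> along
    \<open>X\<close> cancel, the Killing equation says that the change of the metric coefficients
    along \<open>X\<close> is offset by the derivatives of \<open>X\<close>.\<close>
  have "?X p $ 1 * (Y p $ 2 * (p $ 1 * Z p $ 2 + Z p $ 3) + (p $ 1 * Y p $ 2 + Y p $ 3) * Z p $ 2)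
      = - heis_metric lam p (deriv_along Y ?X p) (Z p) - heis_metric lam p (Y p) (deriv_along Z ?X p)"
    using lam unfolding heis_metric_def dX X by (simp add: field_simps power2_eq_square)
  with s show "deriv_along ?X (\<lambda>q. heis_metric lam q (Y q) (Z q)) p
      = heis_metric lam p (lie_bracket ?X Y p) (Z p) + heis_metric lam p (Y p) (lie_bracket ?X Z p)"
    unfolding deriv_along_heis_metric[OF s] lie_bracket_def
      smooth_metric.diff_left[OF smooth_metric_heis[OF lam]]
      smooth_metric.diff_right[OF smooth_metric_heis[OF lam]]
    by linarith
qed (use lam in auto)

theorem theorem3p1:
  fixes lam :: real and f1 f2 f3 :: "real^3 \<Rightarrow> real"
  assumes "lam > 0" and "smooth f1" and "smooth f2" and "smooth f3"
  shows "affine_vector_field (heis_metric lam)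
           (\<lambda>p. f1 p *\<^sub>R heis_e1 p + f2 p *\<^sub>R heis_e2 lam p + f3 p *\<^sub>R heis_e3 p)
     \<longleftrightarrow> (\<exists>c1 c2 c3 c4 :: real. \<forall>x y z :: real.
            f1 (vector [x, y, z]) = c1 * x + c2 \<and>
            f2 (vector [x, y, z]) = - lam * c1 * y + c3 \<and>
            f3 (vector [x, y, z]) =
              lam\<^sup>2 * c1 / 2 * y\<^sup>2 + c1 / 2 * x\<^sup>2 + c2 * x - lam * c3 * y + c4)"
    (is "?affine \<longleftrightarrow> ?explicit")
proof
  assume ?affine
  from affine_imp_explicit[OF assms this] show ?explicit
    by (elim exE) (intro exI, auto)
next
  assume ?explicit
  then obtain c1 c2 c3 c4 where c: "\<And>x y z. f1 (vector [x, y, z]) = c1 * x + c2 \<and>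
      f2 (vector [x, y, z]) = - lam * c1 * y + c3 \<and>
      f3 (vector [x, y, z]) =
        lam\<^sup>2 * c1 / 2 * y\<^sup>2 + c1 / 2 * x\<^sup>2 + c2 * x - lam * c3 * y + c4"
    by blast
  have "p = vector [p $ 1, p $ 2, p $ 3]" for p :: "real^3"
    by (simp add: vec_eq_iff forall_3)
  with c show ?affine
    by (intro explicit_imp_affine[OF assms, of c1 c2 c3 c4]) metis+
qed

end
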